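(* Let $q\in\mathbb{R}^d$ be sampled with $q_k$ i.i.d. uniform on $[-\varepsilon_A,\varepsilon_A]$, and let $(x^*,u^*,\sigma^* )$ be a solution of Problem P$(q)$ with dual variables $\eta^*$. If $\eta_N^*\neq 0$, then, with probability 1, lossless convexification is violated on at most $n_x+1$ vertices, i.e. $\rho_{\min}\le\|u_i^*\|\le\rho_{\max}$ fails for at most $n_x+1$ indices $i\in\{1,\dots,N+1\}$.
   Context: Data. Let $n_x,n_u,n_G,N$ be positive integers, $t_f>0$, $h=t_f/N$, $A_c\in\mathbb{R}^{n_x\times n_x}$, $B_c\in\mathbb{R}^{n_x\times n_u}$, and $$A=e^{hA_c},\quad B_0=\int_0^h e^{(h-s)A_c}B_c\left(1-\tfrac{s}{h}\right)ds,\quad B_1=\int_0^h e^{(h-s)A_c}B_c\,\tfrac{s}{h}\,ds .$$ Let $0<\rho_{\min}<\rho_{\max}$, let $m:\mathbb{R}^{n_x}\to\mathbb{R}$ be convex and $C^1$, let $l_i:\mathbb{R}\to\mathbb{R}$ ($1\le i\le N+1$) be monotonically increasing, convex and $C^1$, let $G:\mathbb{R}^{n_x}\to\mathbb{R}^{n_G}$ be affine, and let $x_{\rm init}\in\mathbb{R}^{n_x}$. $\|\cdot\|$ is the Euclidean norm. Variables are $x=(x_1,\dots,x_{N+1})$, $u=(u_1,\dots,u_{N+1})$, $\sigma=(\sigma_1,\dots,\sigma_{N+1})$ with $x_i\in\mathbb{R}^{n_x}$, $u_i\in\mathbb{R}^{n_u}$, $\sigma_i\in\mathbb{R}$. Problem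 D: minimize $m(x_{N+1})+\sum_{i=1}^{N+1}l_i(\sigma_i)$ over $(x,u,\sigma)$ subject to $x_{i+1}=Ax_i+B_0u_i+B_1u_{i+1}$ for $1\le i\le N$; $\rho_{\min}\le\sigma_i\le\rho_{\max}$ and $\|u_i\|\le\sigma_i$ for $1\le i\le N+1$; $x_1=x_{\rm init}$; $G(x_{N+1})=0$. Perturbation: let $A=PJP^{-1}$ be the Jordan normal form of $A$, with distinct eigenvalues $\lambda_1,\dots,\lambda_d$. For $q\in\mathbb{R}^d$, $\tilde A(q)=P\tilde JP^{-1}$, where $\tilde J$ is obtained from $J$ by replacing each $\lambda_k$ with $\lambda_k+q_k$ (Jordan block structure unchanged). Problem P$(q)$ is Problem D with $A$ replaced by $\tilde A(q)$ ($B_0,B_1$ unchanged). Dual variables: the Lagrangian of Problem P$(q)$ is $$\mathcal L(x,u,\sigma,\eta,\mu_1,\mu_2)=m(x_{N+1})+\sum_{i=1}^{N+1}l_i(\sigma_i)+\sum_{i=1}^N\eta_i^\top(-x_{i+1}+\tilde A(q)x_i+B_0u_i+B_1u_{i+1})+\mu_1^\top(x_1-x_{\rm init})+\mu_2^\top G(x_{N+1})+\sum_{i=1}^{N+1}I_V(u_i,\sigma_i),$$ where $V=\{(u,\sigma):\rho_{\min}\le\sigma\le\rho_{\max},\|u\|\le\sigma\}$, $I_V=0$ on $V$ and $+\infty$ off $V$, $\eta_i,\mu_1\in\mathbb{R}^{n_x}$, $\mu_2\in\mathbb{R}^{n_G}$. For a solution $(x^*,u^*,\sigma^* )$, $\eta^*=(\eta_1^*,\dots,\eta_N^*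 ),\mu_1^*,\mu_2^*$ denote dual variables such that $(x^*,u^*,\sigma^* )$ minimizes $\mathcal L(\cdot,\cdot,\cdot,\eta^*,\mu_1^*,\mu_2^* )$. Lossless convexification (LCvx) holds at vertex $i$ if $\rho_{\min}\le\|u_i\|\le\rho_{\max}$, and is violated there otherwise. Assumption 1 (for Problem D), in force: (1) there is a feasible trajectory with $\|u_i\|<\rho_{\max}$ for all $i$; (2) $\mathrm{rank}\,[(B_0+AB_1)\ \cdots\ A^{n_x-1}(B_0+AB_1)]=n_x$; (3) writing all equality constraints as $H(z)=0$ with $z=(x,u,\sigma)$ and $H$ affine into $\mathbb{R}^{n_H}$, $\mathrm{rank}\,\nabla H(z)=n_H$; (4) for any optimal solution $(x^*,u^*,\sigma^* )$, if $x_{N+1}^*$ minimizes $m(x)$ subject to $G(x)=0$, then some $\|u_i^*\|>0$. Choice of $\varepsilon_A$: for a given tolerance $\delta>0$, $\varepsilon_A>0$ is such that for all $q\in[-\varepsilon_A,\varepsilon_A]^d$, Problem P$(q)$ still satisfies Assumption 1 (with $\tilde A(q)$ in place of $A$) and, with $u^*$ optimal for P$(q)$ and $\tilde x_{N+1}$ obtained by iterating $x_{i+1}=Ax_i+B_0u_i^*+B_1u_{i+1}^*$ from $x_1=x_{\rm init}$, one has $\|G(\tilde x_{N+1})\|\le\delta$ and $|m(\tilde x_{N+1})+\sum_i l_i(\|u_i^*\|)-m^*|\le\delta$, $m^*$ being the optimal cost of Problem D.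
   Formalization: The choice of ε_A additionally requires that Ã(q) be a real matrix for all q in [-ε_A, ε_A]^d (in effect, A has only real eigenvalues); otherwise independent perturbation of conjugate eigenvalues makes Ã(q) non-real and Problem P(q) undefined. *)

theory Defs
  imports
    "HOL-Analysis.Analysis"
    "HOL-Analysis.Finite_Function_Topology"
    "HOL-Probability.Probability"
    "Jordan_Normal_Form.Jordan_Normal_Form"
begin

text \<open>
  Vectors and matrices are those of HOL-Analysis; the names and notation of the matrix library of
  Jordan_Normal_Form that clash with them are hidden. Only \<open>jordan_matrix\<close> and the
  indexing operator \<open>$$\<close> are used from there.
\<close>

hide_const (open) Matrix.mat Matrix.vec Matrix.row Matrix.rows Matrix.col Matrix.cols
  Determinant.det
no_notation vec_index (infixl \<open>$\<close> 100)

section \<open>Problem D\<close>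

definition C1_fun :: "('a::real_normed_vector \<Rightarrow> 'b::real_normed_vector) \<Rightarrow> bool" where
  "C1_fun f \<longleftrightarrow> (\<exists>f'. (\<forall>x. (f has_derivative blinfun_apply (f' x)) (at x)) \<and> continuous_on UNIV f')"

definition affine_map :: "('a::real_vector \<Rightarrow> 'b::real_vector) \<Rightarrow> bool" where
  "affine_map f \<longleftrightarrow> (\<exists>L c. linear L \<and> f = (\<lambda>x. L x + c))"

primrec matpow :: "'a::semiring_1^'n^'n \<Rightarrow> nat \<Rightarrow> 'a^'n^'n" where
  "matpow M 0 = mat 1"
| "matpow M (Suc k) = M ** matpow M k"

definition matexp :: "real^'n^'n \<Rightarrow> real^'n^'n" where
  "matexp M = suminf (\<lambda>k. (1 / fact k) *\<^sub>R matpow M k)"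

text \<open>
  The data of an instance of Problem D. In \<open>stage_cost\<close> the first argument is the vertex
  index. Trajectories are functions on \<open>nat\<close>, of which only the values at the vertices
  \<open>1..N+1\<close> matter.
\<close>

record ('x, 'u, 'g) ocp =
  horizon :: nat
  mat_A :: "real^'x^'x"
  mat_B0 :: "real^'u^'x"
  mat_B1 :: "real^'u^'x"
  rho_min :: real
  rho_max :: real
  term_cost :: "real^'x \<Rightarrow> real"
  stage_cost :: "nat \<Rightarrow> real \<Rightarrow> real"
  term_con :: "real^'x \<Rightarrow> real^'g"
  x_init :: "real^'x"

definition problem_D ::
  "real \<Rightarrow> nat \<Rightarrow> real^'x^'x \<Rightarrow> real^'u^'x \<Rightarrow> real \<Rightarrow> real \<Rightarrow> (real^'x \<Rightarrow> real)
    \<Rightarrow> (nat \<Rightarrow> real \<Rightarrow> real) \<Rightarrow> (real^'x \<Rightarrow> real^'g) \<Rightarrow> real^'x \<Rightarrow> ('x::finite, 'u::finite, 'g::finite) ocp"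
where
  "problem_D tf N Ac Bc rmin rmax m l G xinit =
    (let h = tf / real N in
      \<lparr> horizon = N,
        mat_A = matexp (h *\<^sub>R Ac),
        mat_B0 = integral {0..h} (\<lambda>s. (1 - s / h) *\<^sub>R (matexp ((h - s) *\<^sub>R Ac) ** Bc)),
        mat_B1 = integral {0..h} (\<lambda>s. (s / h) *\<^sub>R (matexp ((h - s) *\<^sub>R Ac) ** Bc)),
        rho_min = rmin, rho_max = rmax,
        term_cost = m, stage_cost = l, term_con = G, x_init = xinit \<rparr>)"

definition feasible ::
  "('x::finite, 'u::finite, 'g::finite) ocp \<Rightarrow> (nat \<Rightarrow> real^'x) \<Rightarrow> (nat \<Rightarrow> real^'u) \<Rightarrow> (nat \<Rightarrow> real) \<Rightarrow> bool"
where
  "feasible D x u \<sigma> \<longleftrightarrow>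
    (\<forall>i\<in>{1..horizon D}. x (i + 1) = mat_A D *v x i + mat_B0 D *v u i + mat_B1 D *v u (i + 1)) \<and>
    (\<forall>i\<in>{1..horizon D + 1}. rho_min D \<le> \<sigma> i \<and> \<sigma> i \<le> rho_max D \<and> norm (u i) \<le> \<sigma> i) \<and>
    x 1 = x_init D \<and>
    term_con D (x (horizon D + 1)) = 0"

definition cost :: "('x::finite, 'u::finite, 'g::finite) ocp \<Rightarrow> (nat \<Rightarrow> real^'x) \<Rightarrow> (nat \<Rightarrow> real) \<Rightarrow> real" where
  "cost D x \<sigma> = term_cost D (x (horizon D + 1)) + (\<Sum>i=1..horizon D + 1. stage_cost D i (\<sigma> i))"

definition optimal ::
  "('x::finite, 'u::finite, 'g::finite) ocp \<Rightarrow> (nat \<Rightarrow> real^'x) \<Rightarrow> (nat \<Rightarrow> real^'u) \<Rightarrow> (nat \<Rightarrow> real) \<Rightarrow> bool"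
where
  "optimal D x u \<sigma> \<longleftrightarrow> feasible D x u \<sigma> \<and>
    (\<forall>x' u' \<sigma>'. feasible D x' u' \<sigma>' \<longrightarrow> cost D x \<sigma> \<le> cost D x' \<sigma>')"

definition optimal_cost :: "('x::finite, 'u::finite, 'g::finite) ocp \<Rightarrow> real" where
  "optimal_cost D = Inf {cost D x \<sigma> | x u \<sigma>. feasible D x u \<sigma>}"

section \<open>Lagrangian\<close>

definition input_set :: "('x::finite, 'u::finite, 'g::finite) ocp \<Rightarrow> ((real^'u) \<times> real) set" where
  "input_set D = {(u, \<sigma>). rho_min D \<le> \<sigma> \<and> \<sigma> \<le> rho_max D \<and> norm u \<le> \<sigma>}"

definition ind_fun :: "'a set \<Rightarrow> 'a \<Rightarrow> ereal" where
  "ind_fun V z = (if z \<in> V then 0 else \<infinity>)"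

definition lagrangian ::
  "('x::finite, 'u::finite, 'g::finite) ocp \<Rightarrow> (nat \<Rightarrow> real^'x) \<Rightarrow> (nat \<Rightarrow> real^'u) \<Rightarrow> (nat \<Rightarrow> real)
    \<Rightarrow> (nat \<Rightarrow> real^'x) \<Rightarrow> real^'x \<Rightarrow> real^'g \<Rightarrow> ereal"
where
  "lagrangian D x u \<sigma> \<eta> \<mu>1 \<mu>2 =
    ereal (term_cost D (x (horizon D + 1)) + (\<Sum>i=1..horizon D + 1. stage_cost D i (\<sigma> i))
      + (\<Sum>i=1..horizon D.
          \<eta> i \<bullet> (- x (i + 1) + mat_A D *v x i + mat_B0 D *v u i + mat_B1 D *v u (i + 1)))
      + \<mu>1 \<bullet> (x 1 - x_init D)
      + \<mu>2 \<bullet> term_con D (x (horizon D + 1)))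
    + (\<Sum>i=1..horizon D + 1. ind_fun (input_set D) (u i, \<sigma> i))"

definition dual_vars ::
  "('x::finite, 'u::finite, 'g::finite) ocp \<Rightarrow> (nat \<Rightarrow> real^'x) \<Rightarrow> (nat \<Rightarrow> real^'u) \<Rightarrow> (nat \<Rightarrow> real)
    \<Rightarrow> (nat \<Rightarrow> real^'x) \<Rightarrow> real^'x \<Rightarrow> real^'g \<Rightarrow> bool"
where
  "dual_vars D x u \<sigma> \<eta> \<mu>1 \<mu>2 \<longleftrightarrow>
    (\<forall>x' u' \<sigma>'. lagrangian D x u \<sigma> \<eta> \<mu>1 \<mu>2 \<le> lagrangian D x' u' \<sigma>' \<eta> \<mu>1 \<mu>2)"

definition LCvx_at :: "('x::finite, 'u::finite, 'g::finite) ocp \<Rightarrow> (nat \<Rightarrow> real^'u) \<Rightarrow> nat \<Rightarrow> bool" where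
  "LCvx_at D u i \<longleftrightarrow> rho_min D \<le> norm (u i) \<and> norm (u i) \<le> rho_max D"

section \<open>Assumption 1\<close>

text \<open>
  The block matrix with blocks \<open>A^k (B0 + A B1)\<close> for \<open>k < CARD('x)\<close>. A column index
  \<open>(b, j)\<close> stands for column \<open>j\<close> of the block whose exponent is the position of
  \<open>b\<close> in an enumeration of \<open>'x\<close>; the order of the blocks has no influence on the rank.
\<close>

definition ctrl_matrix :: "('x::finite, 'u::finite, 'g::finite) ocp \<Rightarrow> real^('x \<times> 'u)^'x" where
  "ctrl_matrix D = (\<chi> i c. (matpow (mat_A D) (to_nat_on (UNIV :: 'x set) (fst c))
      ** (mat_B0 D + mat_A D ** mat_B1 D)) $ i $ snd c)"

text \<open>
  All equality constraints as one map \<open>H\<close>. Finitely supported functions on \<open>nat\<close> are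
  used here because they form a normed space for every horizon, so that the derivative and its
  rank (the dimension of its range) are available. Coordinates beyond the vertices
  \<open>1..N+1\<close> do not enter \<open>H\<close>, and the value of \<open>H\<close> has
  \<open>n_H = N * n_x + n_x + n_G\<close> real components.
\<close>

definition eq_con ::
  "('x::finite, 'u::finite, 'g::finite) ocp \<Rightarrow>
    (nat \<Rightarrow>\<^sub>0 real^'x) \<times> (nat \<Rightarrow>\<^sub>0 real^'u) \<times> (nat \<Rightarrow>\<^sub>0 real) \<Rightarrow>
    (nat \<Rightarrow>\<^sub>0 real^'x) \<times> (real^'x) \<times> (real^'g)"
where
  "eq_con D = (\<lambda>(x, u, \<sigma>).
    (\<Sum>i=1..horizon D. Poly_Mapping.single i
        (- Poly_Mapping.lookup x (i + 1) + mat_A D *v Poly_Mapping.lookup x i + mat_B0 D *v Poly_Mapping.lookup u i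
          + mat_B1 D *v Poly_Mapping.lookup u (i + 1)),
     Poly_Mapping.lookup x 1 - x_init D,
     term_con D (Poly_Mapping.lookup x (horizon D + 1))))"

definition eq_con_full_rank :: "('x::finite, 'u::finite, 'g::finite) ocp \<Rightarrow> bool" where
  "eq_con_full_rank D \<longleftrightarrow>
    (\<forall>z. \<exists>H'. (eq_con D has_derivative H') (at z) \<and>
      dim (range H') = horizon D * CARD('x) + CARD('x) + CARD('g))"

definition assumption_1 :: "('x::finite, 'u::finite, 'g::finite) ocp \<Rightarrow> bool" where
  "assumption_1 D \<longleftrightarrow>
    (\<exists>x u \<sigma>. feasible D x u \<sigma> \<and> (\<forall>i\<in>{1..horizon D + 1}. norm (u i) < rho_max D)) \<and>
    rank (ctrl_matrix D) = CARD('x) \<and>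
    eq_con_full_rank D \<and>
    (\<forall>x u \<sigma>. optimal D x u \<sigma> \<longrightarrow>
      (\<forall>y. term_con D y = 0 \<longrightarrow> term_cost D (x (horizon D + 1)) \<le> term_cost D y) \<longrightarrow>
      (\<exists>i\<in>{1..horizon D + 1}. norm (u i) > 0))"

section \<open>Perturbation of the eigenvalues\<close>

definition cmat :: "real^'n^'m \<Rightarrow> complex^'n^'m" where
  "cmat M = (\<chi> i j. complex_of_real (M $ i $ j))"

text \<open>
  A Jordan matrix is given by the list \<open>bs\<close> of its blocks; a pair \<open>(s, k)\<close> is a block of
  size \<open>s\<close> for the eigenvalue \<open>lam k\<close>. Row and column indices are transported to
  \<open>'n\<close> along an enumeration of \<open>'n\<close>.
\<close>

definition jordan_form :: "(nat \<Rightarrow> complex) \<Rightarrow> (nat \<times> nat) list \<Rightarrow> complex^'n^'n" where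
  "jordan_form lam bs = (\<chi> i j. jordan_matrix (map (\<lambda>(s, k). (s, lam k)) bs) $$
      (to_nat_on (UNIV :: 'n set) i, to_nat_on (UNIV :: 'n set) j))"

definition jordan_decomposition ::
  "real^'n^'n \<Rightarrow> complex^'n^'n \<Rightarrow> nat \<Rightarrow> (nat \<Rightarrow> complex) \<Rightarrow> (nat \<times> nat) list \<Rightarrow> bool"
where
  "jordan_decomposition A P d lam bs \<longleftrightarrow>
    invertible P \<and> inj_on lam {1..d} \<and>
    snd ` set bs = {1..d} \<and> 0 \<notin> fst ` set bs \<and> sum_list (map fst bs) = CARD('n) \<and>
    cmat A = P ** jordan_form lam bs ** matrix_inv P"

definition perturbed_matrix ::
  "complex^'n^'n \<Rightarrow> (nat \<Rightarrow> complex) \<Rightarrow> (nat \<times> nat) list \<Rightarrow> (nat \<Rightarrow> real) \<Rightarrow> complex^'n^'n"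
where
  "perturbed_matrix P lam bs q =
    P ** jordan_form (\<lambda>k. lam k + complex_of_real (q k)) bs ** matrix_inv P"

text \<open>
  Problem P(q) is an instance of Problem D only if the perturbed matrix is real;
  \<open>perturbation_radius\<close> below demands this for all admitted \<open>q\<close>, so that
  taking real parts merely changes the type.
\<close>

definition problem_P ::
  "('x::finite, 'u::finite, 'g::finite) ocp \<Rightarrow> complex^'x^'x \<Rightarrow> (nat \<Rightarrow> complex)
    \<Rightarrow> (nat \<times> nat) list \<Rightarrow> (nat \<Rightarrow> real) \<Rightarrow> ('x, 'u, 'g) ocp"
where
  "problem_P D P lam bs q = D\<lparr>mat_A := (\<chi> i j. Re (perturbed_matrix P lam bs q $ i $ j))\<rparr>"

text \<open>The requirements on \<open>\<epsilon>_A\<close> for the tolerance \<open>\<delta>\<close>.\<close>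

definition perturbation_radius ::
  "('x::finite, 'u::finite, 'g::finite) ocp \<Rightarrow> complex^'x^'x \<Rightarrow> nat \<Rightarrow> (nat \<Rightarrow> complex)
    \<Rightarrow> (nat \<times> nat) list \<Rightarrow> real \<Rightarrow> real \<Rightarrow> bool"
where
  "perturbation_radius D P d lam bs \<delta> \<epsilon> \<longleftrightarrow> \<epsilon> > 0 \<and>
    (\<forall>q. (\<forall>k\<in>{1..d}. q k \<in> {-\<epsilon>..\<epsilon>}) \<longrightarrow>
      (\<forall>i j. perturbed_matrix P lam bs q $ i $ j \<in> \<real>) \<and>
      assumption_1 (problem_P D P lam bs q) \<and>
      (\<forall>x u \<sigma> y. optimal (problem_P D P lam bs q) x u \<sigma> \<longrightarrow>
        y 1 = x_init D \<longrightarrow>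
        (\<forall>i\<in>{1..horizon D}. y (i + 1) = mat_A D *v y i + mat_B0 D *v u i + mat_B1 D *v u (i + 1)) \<longrightarrow>
        norm (term_con D (y (horizon D + 1))) \<le> \<delta> \<and>
        \<bar>term_cost D (y (horizon D + 1)) + (\<Sum>i=1..horizon D + 1. stage_cost D i (norm (u i)))
          - optimal_cost D\<bar> \<le> \<delta>))"

end

theory Submission
  imports Defs
begin

text \<open>
  If LCvx fails at a vertex \<open>2 \<le> i \<le> N\<close>, then \<open>u i\<close> is strictly shorter than
  \<open>\<sigma> i\<close> and can be moved in every direction, so minimality of the Lagrangian gives
  \<open>\<eta>\<^sub>N\<^sup>T A ^ (N - i) (B\<^sub>0 + A B\<^sub>1) = 0\<close>. For \<open>n\<^sub>x\<close> distinct exponents \<open>N - i\<close> the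
  corresponding powers of \<open>A\<close> almost surely span all powers of \<open>A\<close>, and then controllability
  forces \<open>\<eta>\<^sub>N = 0\<close>. So there are at most \<open>n\<^sub>x - 1\<close> violations at inner vertices, and the
  vertices \<open>1\<close> and \<open>N + 1\<close> contribute at most two more.

  For the spanning property, expand \<open>A ^ j\<close> in the Newton basis \<open>\<Prod>k<i. (A - \<nu>\<^sub>k)\<close>, where
  \<open>\<nu>\<close> is the diagonal of the Jordan form; the basis elements with \<open>i \<ge> n\<^sub>x\<close> vanish. The
  determinant of the coefficients is a polynomial in the eigenvalues. It is not the zero polynomial:
  with all eigenvalues equal to \<open>1\<close> the coefficients are binomial coefficients \<open>j choose i\<close>, and
  a polynomial of degree less than \<open>n\<^sub>x\<close> cannot vanish at \<open>n\<^sub>x\<close> exponents. By Fubini it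
  is almost surely nonzero at the perturbed eigenvalues.
\<close>

section \<open>Powers of a matrix in a Newton basis\<close>

text \<open>
  \<open>newton_coeff \<nu> j i\<close> is the coefficient of \<open>(X - \<nu> 0) \<cdots> (X - \<nu> (i - 1))\<close>
  in the expansion of \<open>X ^ j\<close>.
\<close>

fun newton_coeff :: "(nat \<Rightarrow> 'a::comm_ring_1) \<Rightarrow> nat \<Rightarrow> nat \<Rightarrow> 'a" where
  "newton_coeff \<nu> 0 i = (if i = 0 then 1 else 0)"
| "newton_coeff \<nu> (Suc j) i =
    (if i = 0 then 0 else newton_coeff \<nu> j (i - 1)) + \<nu> i * newton_coeff \<nu> j i"

primrec newton_mat :: "(nat \<Rightarrow> 'a::comm_ring_1) \<Rightarrow> 'a^'n^'n \<Rightarrow> nat \<Rightarrow> 'a^'n^'n" where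
  "newton_mat \<nu> A 0 = mat 1"
| "newton_mat \<nu> A (Suc k) = newton_mat \<nu> A k ** (A - mat (\<nu> k))"

lemma newton_coeff_eq_0: "j < i \<Longrightarrow> newton_coeff \<nu> j i = 0"
  by (induction j arbitrary: i) auto

text \<open>With all nodes equal to 1 the recursion is Pascal's rule. This supplies the reference
  point at which the determinant is nonzero.\<close>

lemma newton_coeff_const_1: "newton_coeff (\<lambda>_. 1) j i = of_nat (j choose i)"
proof (induction j arbitrary: i)
  case 0
  then show ?case by (cases i) auto
next
  case (Suc j)
  then show ?case by (cases i) auto
qed

lemma matpow_Suc_right: "matpow A (Suc k) = matpow A k ** A"
  by (induction k) (simp_all add: matrix_mul_assoc)

lemma mult_mat_nth:
  fixes X :: "'a::comm_ring_1^'n^'n"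
  shows "(X ** mat c) $ a $ b = c * X $ a $ b"
  by (simp add: matrix_matrix_mult_def Finite_Cartesian_Product.mat_def if_distrib mult.commute cong: if_cong)

lemma mat_mult_nth:
  fixes X :: "'a::comm_ring_1^'n^'n"
  shows "(mat c ** X) $ a $ b = c * X $ a $ b"
  by (simp add: matrix_matrix_mult_def Finite_Cartesian_Product.mat_def if_distrib[of "\<lambda>x. x * _"] cong: if_cong)

lemma newton_mat_mult:
  "(newton_mat \<nu> A i ** A) $ a $ b = newton_mat \<nu> A (Suc i) $ a $ b + \<nu> i * newton_mat \<nu> A i $ a $ b"
proof -
  have "newton_mat \<nu> A i ** A = newton_mat \<nu> A (Suc i) + newton_mat \<nu> A i ** mat (\<nu> i)"
    by (simp flip: matrix_add_ldistrib)
  then show ?thesis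
    by (simp add: mult_mat_nth)
qed

lemma matpow_newton:
  "j < K \<Longrightarrow> matpow A j $ a $ b = (\<Sum>i<K. newton_coeff \<nu> j i * newton_mat \<nu> A i $ a $ b)"
proof (induction j arbitrary: a b)
  case 0
  have "newton_coeff \<nu> 0 i * newton_mat \<nu> A i $ a $ b = (if i = 0 then mat 1 $ a $ b else 0)" for i
    by simp
  with 0 show ?case by simp
next
  case (Suc j)
  from Suc.prems obtain L where L: "K = Suc L" "j < L" by (cases K) auto
  have "matpow A (Suc j) $ a $ b = (\<Sum>c\<in>UNIV. matpow A j $ a $ c * A $ c $ b)"
    by (simp add: matpow_Suc_right matrix_matrix_mult_def del: matpow.simps)
  also have "\<dots> = (\<Sum>c\<in>UNIV. \<Sum>i<K. newton_coeff \<nu> j i * (newton_mat \<nu> A i $ a $ c * A $ c $ b))"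
    using Suc by (simp add: sum_distrib_right mult.assoc)
  also have "\<dots> = (\<Sum>i<K. newton_coeff \<nu> j i * (newton_mat \<nu> A i ** A) $ a $ b)"
    by (subst sum.swap) (simp add: matrix_matrix_mult_def sum_distrib_left)
  also have "\<dots> = (\<Sum>i<K. newton_coeff \<nu> j i * newton_mat \<nu> A (Suc i) $ a $ b)
      + (\<Sum>i<K. \<nu> i * newton_coeff \<nu> j i * newton_mat \<nu> A i $ a $ b)"
    unfolding newton_mat_mult by (simp add: sum.distrib algebra_simps del: newton_mat.simps)
  also have "(\<Sum>i<K. newton_coeff \<nu> j i * newton_mat \<nu> A (Suc i) $ a $ b)
      = (\<Sum>i<K. (if i = 0 then 0 else newton_coeff \<nu> j (i - 1)) * newton_mat \<nu> A i $ a $ b)"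
  proof -
    \<comment> \<open>The top term \<open>i = L\<close> vanishes because \<open>j < L\<close>, which
      leaves room to shift the others up by one index.\<close>
    have "(\<Sum>i<K. newton_coeff \<nu> j i * newton_mat \<nu> A (Suc i) $ a $ b)
        = (\<Sum>i<L. newton_coeff \<nu> j i * newton_mat \<nu> A (Suc i) $ a $ b)"
      using L by (simp add: newton_coeff_eq_0)
    then show ?thesis
      unfolding L(1) by (simp only: sum.lessThan_Suc_shift) simp
  qed
  finally show ?case
    by (simp add: sum.distrib distrib_right)
qed

section \<open>Vanishing of long Newton products (Cayley-Hamilton)\<close>

lemma newton_mat_similar:
  fixes P Q :: "'a::comm_ring_1^'n^'n"
  assumes "P ** Q = mat 1" "Q ** P = mat 1"
  shows "P ** newton_mat \<nu> J k ** Q = newton_mat \<nu> (P ** J ** Q) k"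
proof (induction k)
  case 0
  then show ?case using assms by simp
next
  case (Suc k)
  have c: "P ** mat (\<nu> k) ** Q = mat (\<nu> k)"
  proof -
    have "mat (\<nu> k) ** Q = Q ** mat (\<nu> k)"
      by (simp add: Finite_Cartesian_Product.vec_eq_iff mult_mat_nth mat_mult_nth)
    then show ?thesis using assms by (simp flip: matrix_mul_assoc) (simp add: matrix_mul_assoc)
  qed
  have "newton_mat \<nu> (P ** J ** Q) (Suc k)
    = P ** newton_mat \<nu> J k ** Q ** (P ** J ** Q - P ** mat (\<nu> k) ** Q)"
    by (simp add: Suc c)
  also have "P ** J ** Q - P ** mat (\<nu> k) ** Q = P ** (J - mat (\<nu> k)) ** Q"
    by (simp add: matrix_mul_assoc Finite_Cartesian_Product.vec_eq_iff matrix_matrix_mult_def sum_subtractf algebra_simps sum_distrib_left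
      sum_distrib_right)
  also have "P ** newton_mat \<nu> J k ** Q ** (P ** (J - mat (\<nu> k)) ** Q)
      = P ** newton_mat \<nu> J k ** (Q ** P) ** (J - mat (\<nu> k)) ** Q"
    by (simp add: matrix_mul_assoc)
  finally show ?case by (simp add: assms matrix_mul_assoc)
qed

text \<open>Each factor clears one more column, because its own diagonal entry in that column is
  zero.\<close>

lemma newton_mat_triangular:
  fixes A :: "'a::comm_ring_1^'n::finite^'n"
  defines "idx \<equiv> to_nat_on (UNIV :: 'n set)"
  assumes "\<And>a b. idx b < idx a \<Longrightarrow> A $ a $ b = 0" and "\<And>a. A $ a $ a = \<nu> (idx a)"
  shows "idx b < k \<Longrightarrow> newton_mat \<nu> A k $ a $ b = 0"
proof (induction k arbitrary: a b)
  case (Suc k)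
  have inj: "idx a = idx b \<longleftrightarrow> a = b" for a b
    by (simp add: idx_def countable_finite)
  have "newton_mat \<nu> A k $ a $ c * (A - mat (\<nu> k)) $ c $ b = 0" for c
  proof -
    \<comment> \<open>Either the left factor vanishes by induction, or the right one lies below the
      diagonal, or it is the diagonal entry \<open>\<nu> k - \<nu> k\<close>.\<close>
    consider "idx c < k" | "idx b < idx c" | "idx c = k" "c = b"
      using Suc.prems inj by force
    then show ?thesis
      by cases (use Suc.IH assms(2,3) inj in \<open>auto simp: Finite_Cartesian_Product.mat_def\<close>)
  qed
  then show ?case by (simp add: matrix_matrix_mult_def)
qed simp

lemma to_nat_on_less_CARD: "to_nat_on (UNIV :: 'n::finite set) a < CARD('n)"
  using to_nat_on_finite[of "UNIV :: 'n set"] by (auto simp: bij_betw_def)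

text \<open>Cayley-Hamilton in factored form: every column index is below \<open>k\<close>, so the
  triangular product is zero, and conjugation preserves this.\<close>

lemma newton_mat_eq_0:
  fixes P Q :: "'a::comm_ring_1^'n::finite^'n"
  defines "idx \<equiv> to_nat_on (UNIV :: 'n set)"
  assumes "P ** Q = mat 1" "Q ** P = mat 1"
    and "\<And>a b. idx b < idx a \<Longrightarrow> J $ a $ b = 0" and "\<And>a. J $ a $ a = \<nu> (idx a)"
    and "k \<ge> CARD('n)"
  shows "newton_mat \<nu> (P ** J ** Q) k = 0"
proof -
  have "idx b < k" for b
    using assms(6) to_nat_on_less_CARD[of b] by (simp add: idx_def)
  with assms have "newton_mat \<nu> J k = 0"
    using newton_mat_triangular[of J \<nu> _ k] by (simp add: Finite_Cartesian_Product.vec_eq_iff)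
  then show ?thesis
    using newton_mat_similar[OF assms(2,3), of \<nu> J k]
    by (simp add: Finite_Cartesian_Product.vec_eq_iff matrix_matrix_mult_def)
qed

text \<open>By the Newton expansion every moment \<open>s j\<close> is a combination of the same
  \<open>CARD('n)\<close> numbers. The moments at the exponents \<open>e a\<close> give a square
  linear system for them, whose only solution is zero.\<close>

lemma matpow_moments_eq_0:
  fixes A :: "'a::field^'n::finite^'n" and v w :: "'a^'n" and e :: "'n \<Rightarrow> nat"
  defines "idx \<equiv> to_nat_on (UNIV :: 'n set)"
  defines "s \<equiv> \<lambda>j. \<Sum>a\<in>UNIV. \<Sum>b\<in>UNIV. v $ a * matpow A j $ a $ b * w $ b"
  assumes zero: "\<And>k. k \<ge> CARD('n) \<Longrightarrow> newton_mat \<nu> A k = 0"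
    and det: "det (\<chi> a b. newton_coeff \<nu> (e a) (idx b)) \<noteq> 0"
    and se: "\<And>a. s (e a) = 0"
  shows "s j = 0"
proof -
  define t where "t k = (\<Sum>a\<in>UNIV. \<Sum>b\<in>UNIV. v $ a * newton_mat \<nu> A k $ a $ b * w $ b)" for k
  have bij: "bij_betw idx UNIV {..<CARD('n)}"
    using to_nat_on_finite[of "UNIV :: 'n set"] by (simp add: idx_def)
  have s: "s j = (\<Sum>b\<in>UNIV. newton_coeff \<nu> j (idx b) * t (idx b))" for j
  proof -
    \<comment> \<open>\<open>K\<close> exceeds \<open>j\<close>, as the expansion requires, and
      reaches \<open>CARD('n)\<close>, from where on the terms vanish.\<close>
    define K where "K = max (Suc j) (CARD('n))"
    have "s j = (\<Sum>a\<in>UNIV. \<Sum>b\<in>UNIV. \<Sum>i<K. newton_coeff \<nu> j i * (v $ a * newton_mat \<nu> A i $ a $ b * w $ b))"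
      unfolding s_def by (subst matpow_newton[of j K])
        (simp_all add: K_def sum_distrib_left sum_distrib_right algebra_simps)
    also have "\<dots> = (\<Sum>a\<in>UNIV. \<Sum>i<K. \<Sum>b\<in>UNIV. newton_coeff \<nu> j i * (v $ a * newton_mat \<nu> A i $ a $ b * w $ b))"
      by (intro sum.cong refl sum.swap)
    also have "\<dots> = (\<Sum>i<K. newton_coeff \<nu> j i * t i)"
      by (subst sum.swap) (simp add: t_def sum_distrib_left)
    also have "\<dots> = (\<Sum>i<CARD('n). newton_coeff \<nu> j i * t i)"
      by (rule sum.mono_neutral_right) (auto simp: K_def t_def zero)
    also have "\<dots> = (\<Sum>b\<in>UNIV. newton_coeff \<nu> j (idx b) * t (idx b))"
      using bij by (rule sum.reindex_bij_betw[symmetric])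
    finally show ?thesis .
  qed
  define C where "C = (\<chi> a b. newton_coeff \<nu> (e a) (idx b))"
  have "C *v (\<chi> b. t (idx b)) = 0"
    using se by (simp add: C_def matrix_vector_mult_def Finite_Cartesian_Product.vec_eq_iff s)
  moreover have "invertible C" using det by (simp add: C_def invertible_det_nz)
  ultimately have "(\<chi> b. t (idx b)) = 0"
    using matrix_left_invertible_ker[of C] by (auto simp: invertible_def)
  then have "t (idx b) = 0" for b
    by (simp add: Finite_Cartesian_Product.vec_eq_iff)
  then show ?thesis by (simp add: s)
qed

text \<open>A nonzero kernel vector would give a nonzero polynomial of degree less than
  \<open>CARD('n)\<close>, written in the binomial basis, with the \<open>CARD('n)\<close> distinct
  roots \<open>e a\<close>.\<close>

lemma det_binomial_nonzero:
  fixes e :: "'n::finite \<Rightarrow> nat"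
  assumes "inj e"
  shows "det (\<chi> a b. complex_of_nat (e a choose to_nat_on (UNIV :: 'n set) b)) \<noteq> 0"
proof -
  define idx where "idx = to_nat_on (UNIV :: 'n set)"
  have bij: "bij_betw idx UNIV {..<CARD('n)}"
    using to_nat_on_finite[of "UNIV :: 'n set"] by (simp add: idx_def)
  then have inj: "idx a = idx b \<longleftrightarrow> a = b" for a b
    by (auto simp: bij_betw_def inj_on_def)
  let ?C = "\<chi> a b. complex_of_nat (e a choose idx b)"
  have "v = 0" if "?C *v v = 0" for v
  proof -
    \<comment> \<open>\<open>B k\<close> is the falling factorial of degree \<open>k\<close>;
      divided by \<open>fact k\<close> it takes the value \<open>j choose k\<close> at
      \<open>j\<close>.\<close>
    define B where "B k = (\<Prod>i<k. [:- of_nat i, 1:] :: complex poly)" for k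
    have B: "poly (Polynomial.smult (1 / fact k) (B k)) (of_nat j) = of_nat (j choose k)" for j k
      by (simp add: B_def poly_prod binomial_gbinomial gbinomial_prod_rev lessThan_atLeast0 of_nat_gbinomial
         del: of_nat_gbinomial[symmetric])
    have deg: "Polynomial.degree (B k) = k" for k
      unfolding B_def by (subst degree_prod_eq_sum_degree) auto
    define p where "p = (\<Sum>b\<in>UNIV. Polynomial.smult (v $ b / fact (idx b)) (B (idx b)))"
    have root: "poly p (of_nat (e a)) = 0" for a
    proof -
      have "poly p (of_nat (e a)) = (?C *v v) $ a"
        by (simp add: p_def poly_sum matrix_vector_mult_def mult.commute flip: B)
      with that show ?thesis by simp
    qed
    have "v $ b = 0" for b
    proof (rule ccontr)
      assume "v $ b \<noteq> 0"
      then have "Max (idx ` {c. v $ c \<noteq> 0}) \<in> idx ` {c. v $ c \<noteq> 0}"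
        by (intro Max_in) auto
      \<comment> \<open>\<open>c\<close> carries the nonzero term of highest degree. As
        \<open>B (idx c)\<close> is monic, that coefficient survives in \<open>p\<close>.\<close>
      then obtain c where c: "v $ c \<noteq> 0" and "idx c = Max (idx ` {c. v $ c \<noteq> 0})"
        by auto
      then have max: "idx b \<le> idx c" if "v $ b \<noteq> 0" for b
        using that by simp
      have "Polynomial.coeff p (idx c) = (\<Sum>b\<in>UNIV. v $ b / fact (idx b) * Polynomial.coeff (B (idx b)) (idx c))"
        by (simp add: p_def coeff_sum)
      also have "\<dots> = (\<Sum>b\<in>{c}. v $ b / fact (idx b) * Polynomial.coeff (B (idx b)) (idx c))"
      proof (rule sum.mono_neutral_right)
        show "\<forall>b\<in>UNIV - {c}. v $ b / fact (idx b) * Polynomial.coeff (B (idx b)) (idx c) = 0"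
        proof
          fix b assume "b \<in> UNIV - {c}"
          then have "v $ b = 0 \<or> idx b < idx c" using max[of b] inj[of b c] by force
          then show "v $ b / fact (idx b) * Polynomial.coeff (B (idx b)) (idx c) = 0"
            by (auto simp: coeff_eq_0 deg)
        qed
      qed auto
      also have "\<dots> \<noteq> 0"
      proof -
        have "lead_coeff (B (idx c)) = 1" unfolding B_def by (subst lead_coeff_prod) simp
        then show ?thesis using c by (simp add: deg)
      qed
      finally have "p \<noteq> 0" by auto
      have "Polynomial.degree p \<le> CARD('n) - 1"
        unfolding p_def
      proof (rule degree_sum_le)
        fix b :: 'n
        have "idx b < CARD('n)" using bij by (auto simp: bij_betw_def)
        then show "Polynomial.degree (Polynomial.smult (v $ b / fact (idx b)) (B (idx b))) \<le> CARD('n) - 1"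
          by (auto simp: deg)
      qed simp
      moreover have "CARD('n) \<le> card {z. poly p z = 0}"
      proof -
        have "card (range (\<lambda>a. complex_of_nat (e a))) = CARD('n)"
          using assms by (subst card_image) (auto simp: inj_on_def)
        then show ?thesis
          using root card_mono[OF poly_roots_finite[OF \<open>p \<noteq> 0\<close>], of "range (\<lambda>a. complex_of_nat (e a))"]
          by auto
      qed
      moreover have "card {z. poly p z = 0} \<le> Polynomial.degree p"
        using \<open>p \<noteq> 0\<close> by (rule card_poly_roots_bound)
      ultimately show False using zero_less_card_finite[where 'a='n] by linarith
    qed
    then show ?thesis by (simp add: Finite_Cartesian_Product.vec_eq_iff)
  qed
  then have "invertible ?C"
    by (simp add: invertible_left_inverse matrix_left_invertible_ker)
  then show ?thesis by (simp add: invertible_det_nz idx_def)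
qed

section \<open>Diagonal entries of a Jordan matrix\<close>

lemma jordan_matrix_diag:
  "i < sum_list (map fst bs) \<Longrightarrow>
    jordan_matrix (map (\<lambda>(s, k). (s, \<mu> k)) bs) $$ (i, i) =
      \<mu> (concat (map (\<lambda>(s, k). replicate s k) bs) ! i)"
proof (induction bs arbitrary: i)
  case (Cons b bs)
  obtain s k where b: "b = (s, k)" by force
  have fst: "map (fst \<circ> (\<lambda>(s, k). (s, \<mu> k))) bs = map fst bs"
    by auto
  note dims = jordan_matrix_dim[of "map (\<lambda>(s, k). (s, \<mu> k)) bs", simplified fst map_map]
  show ?case
    using Cons.prems Cons.IH[of "i - s"] dims
    by (auto simp: b jordan_matrix_def Let_def nth_append)
qed simp

section \<open>Zeros of polynomial functions at random points\<close>

text \<open>Polynomials in countably many variables, generated inductively so that measurability and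
  restriction to one variable follow by induction.\<close>

inductive polyfun :: "((nat \<Rightarrow> complex) \<Rightarrow> complex) \<Rightarrow> bool" where
  const: "polyfun (\<lambda>_. c)"
| coord: "polyfun (\<lambda>x. x k)"
| add: "polyfun f \<Longrightarrow> polyfun g \<Longrightarrow> polyfun (\<lambda>x. f x + g x)"
| mult: "polyfun f \<Longrightarrow> polyfun g \<Longrightarrow> polyfun (\<lambda>x. f x * g x)"

lemma polyfun_sum: "(\<And>i. i \<in> I \<Longrightarrow> polyfun (f i)) \<Longrightarrow> polyfun (\<lambda>x. \<Sum>i\<in>I. f i x)"
  by (induction I rule: infinite_finite_induct) (auto intro: polyfun.intros)

lemma polyfun_prod: "(\<And>i. i \<in> I \<Longrightarrow> polyfun (f i)) \<Longrightarrow> polyfun (\<lambda>x. \<Prod>i\<in>I. f i x)"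
  by (induction I rule: infinite_finite_induct) (auto intro: polyfun.intros)

lemma polyfun_det:
  fixes F :: "'n::finite \<Rightarrow> 'n \<Rightarrow> (nat \<Rightarrow> complex) \<Rightarrow> complex"
  assumes "\<And>a b. polyfun (F a b)"
  shows "polyfun (\<lambda>x. det (\<chi> a b. F a b x))"
  unfolding Determinants.det_def by (auto intro!: polyfun_sum polyfun_prod polyfun.intros assms)

lemma polyfun_one_variable:
  "polyfun f \<Longrightarrow> \<exists>p. \<forall>z. f (x(k := z)) = poly p z"
proof (induction rule: polyfun.induct)
  case (const c)
  show ?case by (rule exI[of _ "[:c:]"]) simp
next
  case (coord i)
  show ?case by (rule exI[of _ "if i = k then [:0, 1:] else [:x i:]"]) simp
next
  case (add f g)
  then show ?case by (metis poly_add)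
next
  case (mult f g)
  then show ?case by (metis poly_mult)
qed

lemma borel_measurable_polyfun:
  assumes "polyfun f" and "\<And>k. (\<lambda>w. X w k) \<in> borel_measurable M"
  shows "(\<lambda>w. f (X w)) \<in> borel_measurable M"
  using assms(1) by induction (use assms(2) in \<open>auto intro: borel_measurable_add borel_measurable_times\<close>)

text \<open>Fubini, by induction on the set of randomized coordinates. All others stay frozen at
  \<open>a\<close>, so the base case is \<open>f a \<noteq> 0\<close>.\<close>

lemma AE_polyfun_nonzero:
  fixes f :: "(nat \<Rightarrow> complex) \<Rightarrow> complex" and U :: "nat \<Rightarrow> real measure"
  assumes f: "polyfun f" "f a \<noteq> 0"
    and U: "\<And>k. sigma_finite_measure (U k)" "\<And>k. sets (U k) = sets borel"
      "\<And>k F. finite F \<Longrightarrow> AE y in U k. y \<notin> F"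
    and I: "finite I"
  shows "AE q in PiM I U. f (\<lambda>i. if i \<in> I then lam i + complex_of_real (q i) else a i) \<noteq> 0"
  using I
proof (induction I rule: finite_induct)
  case empty
  then show ?case using f(2) by simp
next
  case (insert k I)
  interpret product_sigma_finite U by (rule product_sigma_finite.intro) (rule U)
  let ?c = "\<lambda>I q i. if i \<in> I then lam i + complex_of_real (q i) else a i"
  have c: "(\<lambda>q. f (?c J q)) \<in> borel_measurable (PiM J U)" for J
  proof (rule borel_measurable_polyfun[OF f(1)])
    fix j
    show "(\<lambda>q. ?c J q j) \<in> borel_measurable (PiM J U)"
    proof (cases "j \<in> J")
      case True
      then have "(\<lambda>q. q j) \<in> PiM J U \<rightarrow>\<^sub>M U j" by measurable
      then have [measurable]: "(\<lambda>q. q j) \<in> borel_measurable (PiM J U)"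
        using U(2)[of j] measurable_cong_sets[of "PiM J U" "PiM J U" "U j" borel] by auto
      show ?thesis using True by simp
    qed simp
  qed
  define Z where "Z = {q \<in> space (PiM (insert k I) U). f (?c (insert k I) q) = 0}"
  have Z: "Z \<in> sets (PiM (insert k I) U)"
    unfolding Z_def using c[of "insert k I"] by measurable
  have "AE q in PiM I U. (\<integral>\<^sup>+ y. indicator Z (q(k := y)) \<partial>U k) = 0"
    using insert.IH AE_space
  proof eventually_elim
    case (elim q)
    have upd: "(\<lambda>y. q(k := y)) \<in> U k \<rightarrow>\<^sub>M PiM (insert k I) U"
      using elim insert.hyps by (intro measurable_component_update)
    obtain p where p: "f ((?c I q)(k := z)) = poly p z" for z
      using polyfun_one_variable[OF f(1), of "?c I q" k] by auto
    \<comment> \<open>Resetting coordinate \<open>k\<close> to \<open>a k\<close> gives back the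
      point of the induction hypothesis, so the section \<open>p\<close> is not the zero
      polynomial.\<close>
    have "poly p (a k) \<noteq> 0"
      using elim insert.hyps p[of "a k"] by (simp add: fun_upd_idem)
    then have "finite {z. poly p z = 0}" by (intro poly_roots_finite) auto
    then have "finite ((\<lambda>y. lam k + complex_of_real y) -` {z. poly p z = 0})"
      by (rule finite_vimageI) (simp add: inj_on_def)
    from U(3)[OF this, of k] have "AE y in U k. indicator Z (q(k := y)) = (0::ennreal)"
    proof eventually_elim
      case (elim y)
      have "?c (insert k I) (q(k := y)) = (?c I q)(k := lam k + complex_of_real y)"
        using insert.hyps by auto
      with elim p show ?case by (simp add: Z_def)
    qed
    then show ?case by (subst nn_integral_0_iff_AE) (use measurable_compose[OF upd borel_measurable_indicator[OF Z]] in auto)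
  qed
  \<comment> \<open>Almost all sections of \<open>Z\<close> are null, hence so is
    \<open>Z\<close>.\<close>
  then have "(\<integral>\<^sup>+ q. \<integral>\<^sup>+ y. indicator Z (q(k := y)) \<partial>U k \<partial>PiM I U) = (\<integral>\<^sup>+ q. 0 \<partial>PiM I U)"
    by (rule nn_integral_cong_AE)
  then have "emeasure (PiM (insert k I) U) Z = 0"
    using insert.hyps Z
    by (simp add: product_nn_integral_insert del: nn_integral_indicator flip: nn_integral_indicator)
  with Z show ?case by (intro AE_I[of _ _ Z]) (auto simp: Z_def)
qed

text \<open>Independence makes the joint law of the samples the product measure, and uniform laws do
  not charge finite sets.\<close>

lemma (in prob_space) AE_polyfun_indep_uniform:
  fixes Q :: "nat \<Rightarrow> 'a \<Rightarrow> real"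
  assumes f: "polyfun f" "f a \<noteq> 0" and I: "finite I" and \<epsilon>: "\<epsilon> > 0"
    and indep: "indep_vars (\<lambda>_. borel) Q I"
    and unif: "\<And>k. k \<in> I \<Longrightarrow> distr M lborel (Q k) = uniform_measure lborel {-\<epsilon>..\<epsilon>}"
  shows "AE w in M. f (\<lambda>i. if i \<in> I then lam i + complex_of_real (Q i w) else a i) \<noteq> 0"
proof (cases "I = {}")
  case True
  then show ?thesis using f(2) by simp
next
  case False
  \<comment> \<open>Defined at every index, also outside \<open>I\<close>, since sigma-finiteness is
    required of the whole family.\<close>
  define U where "U = (\<lambda>k::nat. uniform_measure lborel {-\<epsilon>..\<epsilon>})"
  have rv[measurable]: "random_variable borel (Q k)" if "k \<in> I" for k
    using indep that by (simp add: indep_vars_def)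
  have "distr M (\<Pi>\<^sub>M i\<in>I. borel) (\<lambda>x. \<lambda>i\<in>I. Q i x) = (\<Pi>\<^sub>M i\<in>I. distr M borel (Q i))"
    using indep_vars_iff_distr_eq_PiM'[OF False, where M' = "\<lambda>_. borel" and X = Q] indep rv by simp
  also have "\<dots> = PiM I U"
  proof (rule PiM_cong)
    fix k assume "k \<in> I"
    have "distr M borel (Q k) = distr M lborel (Q k)" by (rule distr_cong) simp_all
    then show "distr M borel (Q k) = U k" using unif[OF \<open>k \<in> I\<close>] by (simp add: U_def)
  qed simp
  finally have eq: "distr M (\<Pi>\<^sub>M i\<in>I. borel) (\<lambda>x. \<lambda>i\<in>I. Q i x) = PiM I U" .
  have prob: "prob_space (U k)" for k
    unfolding U_def using \<epsilon> by (intro prob_space_uniform_measure) auto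
  have "AE q in PiM I U. f (\<lambda>i. if i \<in> I then lam i + complex_of_real (q i) else a i) \<noteq> 0"
  proof (rule AE_polyfun_nonzero[OF f _ _ _ I])
    show "sigma_finite_measure (U k)" for k
      using prob[of k] by (simp add: prob_space_imp_sigma_finite)
    show "sets (U k) = sets borel" for k by (simp add: U_def)
    show "AE y in U k. y \<notin> F" if "finite F" for k F
    proof -
      have "F \<in> null_sets lborel" using that by (rule finite_imp_null_set_lborel)
      then have "AE y in lborel. y \<notin> F" by (rule AE_not_in)
      then show ?thesis
        unfolding U_def by (intro AE_uniform_measureI) auto
    qed
  qed
  then have "AE q in distr M (\<Pi>\<^sub>M i\<in>I. borel) (\<lambda>x. \<lambda>i\<in>I. Q i x).
    f (\<lambda>i. if i \<in> I then lam i + complex_of_real (q i) else a i) \<noteq> 0"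
    by (simp only: eq)
  then have "AE w in M. f (\<lambda>i. if i \<in> I then lam i + complex_of_real ((\<lambda>i\<in>I. Q i w) i) else a i) \<noteq> 0"
    by (rule AE_distrD[rotated]) measurable
  then show ?thesis
    by (simp cong: if_cong)
qed

lemma AE_uniform_in_interval:
  fixes X :: "'a \<Rightarrow> real"
  assumes "X \<in> borel_measurable M" "distr M lborel X = uniform_measure lborel {-\<epsilon>..\<epsilon>}"
  shows "AE w in M. X w \<in> {-\<epsilon>..\<epsilon>}"
proof (rule AE_distrD[of X M lborel])
  show "AE y in distr M lborel X. y \<in> {-\<epsilon>..\<epsilon>}"
    unfolding assms(2) by (intro AE_uniform_measureI) auto
qed (use assms in simp)

section \<open>Consequences of minimizing the Lagrangian\<close>

text \<open>The Lagrangian without its indicator terms, so that variations are computed in the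
  reals.\<close>

definition real_lagrangian ::
  "('x::finite, 'u::finite, 'g::finite) ocp \<Rightarrow> (nat \<Rightarrow> real^'x) \<Rightarrow> (nat \<Rightarrow> real^'u) \<Rightarrow> (nat \<Rightarrow> real)
    \<Rightarrow> (nat \<Rightarrow> real^'x) \<Rightarrow> real^'x \<Rightarrow> real^'g \<Rightarrow> real"
where
  "real_lagrangian D x u \<sigma> \<eta> \<mu>1 \<mu>2 =
    term_cost D (x (horizon D + 1)) + (\<Sum>i=1..horizon D + 1. stage_cost D i (\<sigma> i))
      + (\<Sum>i=1..horizon D.
          \<eta> i \<bullet> (- x (i + 1) + mat_A D *v x i + mat_B0 D *v u i + mat_B1 D *v u (i + 1)))
      + \<mu>1 \<bullet> (x 1 - x_init D)
      + \<mu>2 \<bullet> term_con D (x (horizon D + 1))"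

lemma lagrangian_eq_real_lagrangian:
  assumes "\<And>i. i \<in> {1..horizon D + 1} \<Longrightarrow> (u i, \<sigma> i) \<in> input_set D"
  shows "lagrangian D x u \<sigma> \<eta> \<mu>1 \<mu>2 = ereal (real_lagrangian D x u \<sigma> \<eta> \<mu>1 \<mu>2)"
proof -
  have "(\<Sum>i=1..horizon D + 1. ind_fun (input_set D) (u i, \<sigma> i)) = 0"
    by (rule sum.neutral) (use assms in \<open>auto simp: ind_fun_def\<close>)
  then show ?thesis by (simp add: lagrangian_def real_lagrangian_def)
qed

text \<open>Only the input constraints restrict the competitor; dynamics and boundary conditions are
  priced by the multipliers, so states vary freely.\<close>

lemma real_lagrangian_le:
  assumes "dual_vars D x u \<sigma> \<eta> \<mu>1 \<mu>2" "feasible D x u \<sigma>"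
    and "\<And>i. i \<in> {1..horizon D + 1} \<Longrightarrow> (u' i, \<sigma>' i) \<in> input_set D"
  shows "real_lagrangian D x u \<sigma> \<eta> \<mu>1 \<mu>2 \<le> real_lagrangian D x' u' \<sigma>' \<eta> \<mu>1 \<mu>2"
proof -
  have "(u i, \<sigma> i) \<in> input_set D" if "i \<in> {1..horizon D + 1}" for i
    using assms(2) that by (auto simp: feasible_def input_set_def)
  then show ?thesis
    using assms(1) lagrangian_eq_real_lagrangian[of D u \<sigma>] lagrangian_eq_real_lagrangian[of D u' \<sigma>'] assms(3)
    by (metis dual_vars_def ereal_less_eq(3))
qed

text \<open>A variation at an inner vertex \<open>i\<close> enters exactly two dynamics terms,
  \<open>j = i\<close> and \<open>j = i - 1\<close>.\<close>

lemma sum_two_deltas: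
  fixes f g :: "nat \<Rightarrow> real"
  assumes "i \<in> {2..N}"
  shows "(\<Sum>j=1..N. (if j = i then f j else 0) + (if j + 1 = i then g j else 0)) = f i + g (i - 1 :: nat)"
    (is "?l = _")
proof -
  have "?l = (\<Sum>j=1..N. if j = i then f j else 0) + (\<Sum>j=1..N. if j = i - 1 then g j else 0)"
    unfolding sum.distrib using assms by (intro arg_cong2[of _ _ _ _ "(+)"] sum.cong) auto
  with assms show ?thesis by (simp add: sum.delta) linarith
qed

text \<open>At an inner vertex \<open>x i\<close> is free and enters the Lagrangian only linearly,
  so minimality forces its coefficient to vanish.\<close>

lemma costate_step:
  assumes dual: "dual_vars D x u \<sigma> \<eta> \<mu>1 \<mu>2" "feasible D x u \<sigma>" and i: "i \<in> {2..horizon D}"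
  shows "\<eta> (i - 1) = transpose (mat_A D) *v \<eta> i"
proof -
  have ge: "0 \<le> (\<eta> i v* mat_A D - \<eta> (i - 1)) \<bullet> v" for v
  proof -
    let ?x = "\<lambda>j. x j + (if j = i then v else 0)"
    have "(u i, \<sigma> i) \<in> input_set D" if "i \<in> {1..horizon D + 1}" for i
      using dual(2) that by (auto simp: feasible_def input_set_def)
    with dual have "real_lagrangian D x u \<sigma> \<eta> \<mu>1 \<mu>2 \<le> real_lagrangian D ?x u \<sigma> \<eta> \<mu>1 \<mu>2"
      by (rule real_lagrangian_le)
    also have "\<dots> = real_lagrangian D x u \<sigma> \<eta> \<mu>1 \<mu>2 +
        (\<Sum>j=1..horizon D. (if j = i then \<eta> j \<bullet> (mat_A D *v v) else 0)
           + (if j + 1 = i then - (\<eta> j \<bullet> v) else 0))"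
    proof -
      have "\<eta> j \<bullet> (- ?x (j + 1) + mat_A D *v ?x j + mat_B0 D *v u j + mat_B1 D *v u (j + 1))
        = \<eta> j \<bullet> (- x (j + 1) + mat_A D *v x j + mat_B0 D *v u j + mat_B1 D *v u (j + 1))
          + ((if j = i then \<eta> j \<bullet> (mat_A D *v v) else 0) + (if j + 1 = i then - (\<eta> j \<bullet> v) else 0))" for j
        by (simp add: inner_simps matrix_vector_right_distrib)
      then show ?thesis
        using i unfolding real_lagrangian_def by (simp add: sum.distrib)
    qed
    finally show ?thesis
      unfolding sum_two_deltas[OF i] by (simp add: inner_simps dot_lmul_matrix)
  qed
  \<comment> \<open>Testing with the negative of the coefficient vector bounds its squared norm by
    zero.\<close>
  from ge[of "- (\<eta> i v* mat_A D - \<eta> (i - 1))"]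
  have "(\<eta> i v* mat_A D - \<eta> (i - 1)) \<bullet> (\<eta> i v* mat_A D - \<eta> (i - 1)) \<le> 0" by (simp only: inner_minus_right)
  then have "\<eta> i v* mat_A D - \<eta> (i - 1) = 0"
    by (metis inner_eq_zero_iff inner_ge_zero order_antisym)
  then show ?thesis by simp
qed

text \<open>Below \<open>rho_min D\<close> the bound \<open>norm (u i) \<le> \<sigma> i\<close> is
  slack, so with \<open>\<sigma>\<close> fixed a short step against the gradient \<open>?w\<close>
  would lower the Lagrangian.\<close>

lemma switching_eq_0:
  assumes dual: "dual_vars D x u \<sigma> \<eta> \<mu>1 \<mu>2" "feasible D x u \<sigma>" and i: "i \<in> {2..horizon D}"
    and small: "\<not> LCvx_at D u i"
  shows "\<eta> i v* mat_B0 D + \<eta> (i - 1) v* mat_B1 D = 0"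
proof (rule ccontr)
  let ?w = "\<eta> i v* mat_B0 D + \<eta> (i - 1) v* mat_B1 D"
  assume w: "?w \<noteq> 0"
  have \<sigma>: "rho_min D \<le> \<sigma> j" "\<sigma> j \<le> rho_max D" "norm (u j) \<le> \<sigma> j" if "j \<in> {1..horizon D + 1}" for j
    using dual(2) that by (auto simp: feasible_def)
  \<comment> \<open>The step has length \<open>rho_min D - norm (u i)\<close>, so the moved input
    has norm at most \<open>rho_min D\<close> and remains admissible.\<close>
  define t where "t = (rho_min D - norm (u i)) / norm ?w"
  \<comment> \<open>Feasibility gives the upper bound, so only the lower one can fail.\<close>
  have "norm (u i) < rho_min D"
    using small \<sigma>[of i] i by (auto simp: LCvx_at_def)
  with w have t: "t > 0" and tw: "norm (t *\<^sub>R ?w) = rho_min D - norm (u i)"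
    by (auto simp: t_def)
  let ?u = "\<lambda>j. u j + (if j = i then - t *\<^sub>R ?w else 0)"
  have "(?u j, \<sigma> j) \<in> input_set D" if "j \<in> {1..horizon D + 1}" for j
    using \<sigma>[OF that] norm_triangle_ineq4[of "u i" "t *\<^sub>R ?w"] tw
    by (auto simp: input_set_def)
  with dual have "real_lagrangian D x u \<sigma> \<eta> \<mu>1 \<mu>2 \<le> real_lagrangian D x ?u \<sigma> \<eta> \<mu>1 \<mu>2"
    by (rule real_lagrangian_le)
  also have "\<dots> = real_lagrangian D x u \<sigma> \<eta> \<mu>1 \<mu>2 +
      (\<Sum>j=1..horizon D. (if j = i then - t * ((\<eta> j v* mat_B0 D) \<bullet> ?w) else 0)
         + (if j + 1 = i then - t * ((\<eta> j v* mat_B1 D) \<bullet> ?w) else 0))"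
  proof -
    have "\<eta> j \<bullet> (- x (j + 1) + mat_A D *v x j + mat_B0 D *v ?u j + mat_B1 D *v ?u (j + 1))
      = \<eta> j \<bullet> (- x (j + 1) + mat_A D *v x j + mat_B0 D *v u j + mat_B1 D *v u (j + 1))
        + ((if j = i then - t * ((\<eta> j v* mat_B0 D) \<bullet> ?w) else 0)
         + (if j + 1 = i then - t * ((\<eta> j v* mat_B1 D) \<bullet> ?w) else 0))" for j
    proof -
      have "\<eta> j \<bullet> (B *v (u k + (if k = i then - t *\<^sub>R ?w else 0)))
        = \<eta> j \<bullet> (B *v u k) + (if k = i then - t * ((\<eta> j v* B) \<bullet> ?w) else 0)" for B k
        by (simp only: dot_lmul_matrix[symmetric] inner_add_right) (auto simp: inner_simps)
      then show ?thesis by (simp only: inner_add_right)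
    qed
    then show ?thesis
      unfolding real_lagrangian_def by (simp add: sum.distrib)
  qed
  finally have "t * (?w \<bullet> ?w) \<le> 0"
    unfolding sum_two_deltas[OF i] by (simp add: inner_add_left distrib_left)
  moreover have "0 < t * (?w \<bullet> ?w)"
    using t w inner_gt_zero_iff[of ?w] by (intro mult_pos_pos) blast+
  ultimately show False by simp
qed

section \<open>Orthogonality relations and controllability\<close>

lemma costate_eq_matpow:
  assumes "dual_vars D x u \<sigma> \<eta> \<mu>1 \<mu>2" "feasible D x u \<sigma>" and "i \<in> {1..horizon D}"
  shows "\<eta> i = \<eta> (horizon D) v* matpow (mat_A D) (horizon D - i)"
  using assms(3)
proof (induction "horizon D - i" arbitrary: i)
  case 0
  then show ?case by simp
next
  case (Suc k)
  then have "\<eta> i = \<eta> (i + 1) v* mat_A D"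
    using costate_step[OF assms(1,2), of "i + 1"] by simp
  moreover have "\<eta> (i + 1) = \<eta> (horizon D) v* matpow (mat_A D) k"
  proof -
    have "k = horizon D - (i + 1)" "i + 1 \<in> {1..horizon D}"
      using Suc(2,3) by auto
    then show ?thesis using Suc(1)[of "i + 1"] by simp
  qed
  ultimately show ?case
    by (simp add: matpow_Suc_right vector_matrix_mul_assoc del: matpow.simps flip: Suc(2))
qed

text \<open>The costate recursion turns the gradient in \<open>u i\<close> into
  \<open>\<eta> i\<close> applied to \<open>B0 + A B1\<close>; expressing \<open>\<eta> i\<close>
  through the last costate contributes the power of \<open>A\<close>.\<close>

lemma violation_imp_orthogonal:
  assumes "dual_vars D x u \<sigma> \<eta> \<mu>1 \<mu>2" "feasible D x u \<sigma>" and i: "i \<in> {2..horizon D}"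
    and "\<not> LCvx_at D u i"
  shows "\<eta> (horizon D) \<bullet> (matpow (mat_A D) (horizon D - i) *v ((mat_B0 D + mat_A D ** mat_B1 D) *v v)) = 0"
proof -
  have "\<eta> (horizon D) \<bullet> (matpow (mat_A D) (horizon D - i) *v ((mat_B0 D + mat_A D ** mat_B1 D) *v v))
    = \<eta> i \<bullet> ((mat_B0 D + mat_A D ** mat_B1 D) *v v)"
    using costate_eq_matpow[OF assms(1,2), of i] i by (simp add: dot_lmul_matrix)
  also have "\<dots> = (\<eta> i v* mat_B0 D + \<eta> (i - 1) v* mat_B1 D) \<bullet> v"
    using costate_step[OF assms(1,2) i]
    by (simp add: inner_simps matrix_vector_mult_add_rdistrib dot_lmul_matrix flip: matrix_vector_mul_assoc)
  also have "\<dots> = 0" using switching_eq_0[OF assms] by simp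
  finally show ?thesis .
qed

text \<open>Full rank makes \<open>\<eta>\<close> a combination of the columns of
  \<open>ctrl_matrix D\<close>, to all of which it is orthogonal; hence it is orthogonal to
  itself.\<close>

lemma controllable_imp_eq_0:
  fixes D :: "('x::finite, 'u::finite, 'g::finite) ocp"
  assumes rank: "rank (ctrl_matrix D) = CARD('x)"
    and orth: "\<And>k v. \<eta> \<bullet> (matpow (mat_A D) k *v ((mat_B0 D + mat_A D ** mat_B1 D) *v v)) = 0"
  shows "\<eta> = 0"
proof -
  obtain y where y: "\<eta> = ctrl_matrix D *v y"
    using rank full_rank_surjective[of "ctrl_matrix D"] by (metis surjD)
  have col: "\<eta> \<bullet> column c (ctrl_matrix D) = 0" for c
  proof -
    have "column c (ctrl_matrix D) = matpow (mat_A D) (to_nat_on (UNIV :: 'x set) (fst c)) *v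
        ((mat_B0 D + mat_A D ** mat_B1 D) *v axis (snd c) 1)"
      unfolding matrix_vector_mul_assoc
      unfolding matrix_vector_mult_basis
      by (simp add: ctrl_matrix_def column_def)
    then show ?thesis using orth by simp
  qed
  have "\<eta> \<bullet> \<eta> = \<eta> \<bullet> (ctrl_matrix D *v y)" using y by simp
  also have "\<dots> = (\<Sum>c\<in>UNIV. y $ c * (\<eta> \<bullet> column c (ctrl_matrix D)))"
    by (simp add: matrix_mult_sum inner_sum_right scalar_mult_eq_scaleR)
  finally show ?thesis by (simp add: col)
qed

section \<open>Counting the violations\<close>

lemma cmat_matpow: "cmat (matpow A k) = matpow (cmat A) k"
proof (induction k)
  case 0
  then show ?case by (simp add: cmat_def Finite_Cartesian_Product.mat_def Finite_Cartesian_Product.vec_eq_iff)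
next
  case (Suc k)
  have "cmat (A ** matpow A k) = cmat A ** cmat (matpow A k)"
    by (simp add: cmat_def matrix_matrix_mult_def)
  then show ?case by (simp add: Suc)
qed

text \<open>Moments in complex form, since the Newton nodes are possibly complex
  eigenvalues.\<close>

lemma of_real_inner_matrix:
  "complex_of_real (v \<bullet> (X *v w)) =
    (\<Sum>a\<in>UNIV. \<Sum>b\<in>UNIV. (\<chi> i. complex_of_real (v $ i)) $ a * cmat X $ a $ b * (\<chi> i. complex_of_real (w $ i)) $ b)"
  by (simp add: inner_vec_def matrix_vector_mult_def cmat_def sum_distrib_left mult.assoc)

text \<open>The deterministic part. The generic event is the determinant hypothesis, stated for all
  exponent choices because the violating vertices are not known in advance.\<close>

lemma card_violations_le:
  fixes D :: "('x::finite, 'u::finite, 'g::finite) ocp"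
  assumes zero: "\<And>k. k \<ge> CARD('x) \<Longrightarrow> newton_mat \<nu> (cmat (mat_A D)) k = 0"
    and det: "\<And>e :: 'x \<Rightarrow> nat. inj e \<Longrightarrow> range e \<subseteq> {..<horizon D} \<Longrightarrow>
      det (\<chi> a b. newton_coeff \<nu> (e a) (to_nat_on (UNIV :: 'x set) b)) \<noteq> 0"
    and rank: "rank (ctrl_matrix D) = CARD('x)"
    and dual: "dual_vars D x u \<sigma> \<eta> \<mu>1 \<mu>2" "feasible D x u \<sigma>"
    and "\<eta> (horizon D) \<noteq> 0"
  shows "card {i \<in> {1..horizon D + 1}. \<not> LCvx_at D u i} \<le> CARD('x) + 1"
proof (rule ccontr)
  let ?N = "horizon D"
  assume many: "\<not> card {i \<in> {1..?N + 1}. \<not> LCvx_at D u i} \<le> CARD('x) + 1"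
  \<comment> \<open>The end vertices each enter a single dynamics term and are set aside, at a cost
    of at most two.\<close>
  define V where "V = {i \<in> {2..?N}. \<not> LCvx_at D u i}"
  have "{i \<in> {1..?N + 1}. \<not> LCvx_at D u i} \<subseteq> V \<union> {1, ?N + 1}"
    by (auto simp: V_def)
  then have "card {i \<in> {1..?N + 1}. \<not> LCvx_at D u i} \<le> card (V \<union> {1, ?N + 1})"
    by (intro card_mono) (auto simp: V_def)
  also have "\<dots> \<le> card V + card {1, ?N + 1}"
    by (rule card_Un_le)
  also have "card {1, ?N + 1} \<le> 2"
    by (auto simp: card_insert_if)
  finally have "CARD('x) \<le> card V"
    using many by linarith
  \<comment> \<open>Indexing \<open>CARD('x)\<close> inner violations by \<open>'x\<close> makes the
    system for the moments square.\<close>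
  then obtain g :: "'x \<Rightarrow> nat" where g: "inj g" "range g \<subseteq> V"
    using card_le_inj[of "UNIV :: 'x set" V] by (auto simp: V_def)
  \<comment> \<open>\<open>g a \<le> ?N\<close> keeps the truncated differences distinct, and
    \<open>g a \<ge> 2\<close> keeps them below \<open>?N\<close>.\<close>
  define e where "e a = ?N - g a" for a
  have "inj e"
    using g by (auto simp: V_def inj_on_def e_def image_subset_iff) (metis diff_diff_cancel)
  moreover have "range e \<subseteq> {..<?N}"
    using g(2) by (auto simp: e_def V_def)
  ultimately have det: "det (\<chi> a b. newton_coeff \<nu> (e a) (to_nat_on (UNIV :: 'x set) b)) \<noteq> 0"
    by (rule det)
  have "\<eta> ?N \<bullet> (matpow (mat_A D) k *v ((mat_B0 D + mat_A D ** mat_B1 D) *v v)) = 0" for k v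
  proof -
    let ?w = "(mat_B0 D + mat_A D ** mat_B1 D) *v v"
    have "complex_of_real (\<eta> ?N \<bullet> (matpow (mat_A D) (e a) *v ?w)) = 0" for a
      unfolding of_real_eq_0_iff e_def
      by (rule violation_imp_orthogonal[OF dual]) (use g(2) in \<open>auto simp: V_def\<close>)
    then have eq: "(\<Sum>a\<in>UNIV. \<Sum>b\<in>UNIV. (\<chi> i. complex_of_real (\<eta> ?N $ i)) $ a *
        matpow (cmat (mat_A D)) (e c) $ a $ b * (\<chi> i. complex_of_real (?w $ i)) $ b) = 0" for c
      unfolding of_real_inner_matrix cmat_matpow .
    have "complex_of_real (\<eta> ?N \<bullet> (matpow (mat_A D) k *v ?w)) = 0"
      unfolding of_real_inner_matrix cmat_matpow
      by (rule matpow_moments_eq_0[where e = e and \<nu> = \<nu>, OF zero det eq])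
    then show ?thesis by simp
  qed
  with rank have "\<eta> ?N = 0" by (rule controllable_imp_eq_0)
  with assms(6) show False by simp
qed

section \<open>The Jordan form of the perturbed matrix\<close>

lemma jordan_form_cong:
  assumes "\<And>k. k \<in> snd ` set bs \<Longrightarrow> lam k = mu k"
  shows "jordan_form lam bs = jordan_form mu bs"
proof -
  have "map (\<lambda>(s, k). (s, lam k)) bs = map (\<lambda>(s, k). (s, mu k)) bs"
    using assms by force
  then show ?thesis by (simp only: jordan_form_def)
qed

text \<open>The eigenvalue label at diagonal position \<open>i\<close>. It depends on the block
  structure alone, so one index map serves every perturbation.\<close>

definition jordan_index :: "(nat \<times> nat) list \<Rightarrow> nat \<Rightarrow> nat" where
  "jordan_index bs i = concat (map (\<lambda>(s, k). replicate s k) bs) ! i"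

lemma newton_mat_jordan_eq_0:
  fixes P :: "complex^'n::finite^'n"
  assumes "invertible P" "sum_list (map fst bs) = CARD('n)" "k \<ge> CARD('n)"
  shows "newton_mat (\<lambda>i. mu (jordan_index bs i)) (P ** jordan_form mu bs ** matrix_inv P) k = 0"
proof (rule newton_mat_eq_0[OF _ _ _ _ assms(3)])
  have dim: "sum_list (map fst (map (\<lambda>(s, k). (s, mu k)) bs)) = CARD('n)"
    unfolding assms(2)[symmetric] by (simp add: comp_def case_prod_unfold)
  show "P ** matrix_inv P = mat 1" "matrix_inv P ** P = mat 1"
    using someI_ex[OF assms(1)[unfolded invertible_def]] by (simp_all add: matrix_inv_def)
  show "jordan_form mu bs $ a $ b = 0"
    if "to_nat_on (UNIV :: 'n set) b < to_nat_on UNIV a" for a b :: 'n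
    using that to_nat_on_less_CARD[of a] jordan_matrix_upper_triangular[of _ "map (\<lambda>(s, k). (s, mu k)) bs"]
    unfolding dim by (simp add: jordan_form_def)
  show "jordan_form mu bs $ a $ a = mu (jordan_index bs (to_nat_on UNIV a))" for a :: 'n
    using to_nat_on_less_CARD[of a] jordan_matrix_diag[of _ bs mu] assms(2)
    by (simp add: jordan_form_def jordan_index_def)
qed

lemma polyfun_newton_coeff: "polyfun (\<lambda>x. newton_coeff (\<lambda>i. x (f i)) j i)"
proof (induction j arbitrary: i)
  case 0
  show ?case by (simp add: polyfun.const)
next
  case (Suc j)
  show ?case
    by (cases "i = 0") (auto intro!: polyfun.intros Suc)
qed

theorem theorem1:
  fixes Ac :: "real^'x^'x" and Bc :: "real^'u^'x"
    and tf rmin rmax \<delta> \<epsilon> :: real and N d :: nat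
    and m :: "real^'x \<Rightarrow> real" and l :: "nat \<Rightarrow> real \<Rightarrow> real" and G :: "real^'x \<Rightarrow> real^'g"
    and xinit :: "real^'x" and D :: "('x, 'u, 'g) ocp"
    and P :: "complex^'x^'x" and lam :: "nat \<Rightarrow> complex" and bs :: "(nat \<times> nat) list"
    and M :: "'w measure" and Q :: "nat \<Rightarrow> 'w \<Rightarrow> real"
  assumes "N > 0" and "tf > 0" and "0 < rmin" and "rmin < rmax"
    and "convex_on UNIV m" and "C1_fun m"
    and "\<And>i. i \<in> {1..N + 1} \<Longrightarrow> mono (l i) \<and> convex_on UNIV (l i) \<and> C1_fun (l i)"
    and "affine_map G"
    and D: "D = problem_D tf N Ac Bc rmin rmax m l G xinit"
    and "assumption_1 D"
    and "jordan_decomposition (mat_A D) P d lam bs"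
    and "\<delta> > 0" and "perturbation_radius D P d lam bs \<delta> \<epsilon>"
    and "prob_space M"
    and "prob_space.indep_vars M (\<lambda>_. borel) Q {1..d}"
    and "\<And>k. k \<in> {1..d} \<Longrightarrow> distr M lborel (Q k) = uniform_measure lborel {-\<epsilon>..\<epsilon>}"
  shows "AE \<omega> in M. \<forall>x u \<sigma> \<eta> \<mu>1 \<mu>2.
    optimal (problem_P D P lam bs (\<lambda>k. Q k \<omega>)) x u \<sigma> \<longrightarrow>
    dual_vars (problem_P D P lam bs (\<lambda>k. Q k \<omega>)) x u \<sigma> \<eta> \<mu>1 \<mu>2 \<longrightarrow>
    \<eta> N \<noteq> 0 \<longrightarrow>
    card {i \<in> {1..N + 1}. \<not> LCvx_at D u i} \<le> CARD('x) + 1"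
proof -
  interpret prob_space M by fact
  define \<kappa> where "\<kappa> = jordan_index bs"
  \<comment> \<open>The value 1 outside \<open>{1..d}\<close> agrees with the reference point; no
    Jordan block carries such a label.\<close>
  define \<mu> where "\<mu> \<omega> k = (if k \<in> {1..d} then lam k + complex_of_real (Q k \<omega>) else 1)" for \<omega> k
  \<comment> \<open>\<open>\<kappa>\<close> sends diagonal positions to labels, so
    \<open>F e\<close> is a polynomial in the distinct eigenvalues, which are perturbed
    independently.\<close>
  define F where "F e x = det (\<chi> a b. newton_coeff (\<lambda>i. x (\<kappa> i)) (e a) (to_nat_on (UNIV :: 'x set) b))"
    for e :: "'x \<Rightarrow> nat" and x :: "nat \<Rightarrow> complex"
  have jd: "invertible P" "snd ` set bs = {1..d}" "sum_list (map fst bs) = CARD('x)"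
    using assms(11) by (auto simp: jordan_decomposition_def)
  have \<epsilon>: "\<epsilon> > 0"
    using assms(13) by (simp add: perturbation_radius_def)
  have rv: "Q k \<in> borel_measurable M" if "k \<in> {1..d}" for k
    using assms(15) that by (simp add: indep_vars_def)
  have "AE \<omega> in M. F e (\<mu> \<omega>) \<noteq> 0" if "inj e" for e
  proof -
    have "polyfun (F e)"
      unfolding F_def by (intro polyfun_det polyfun_newton_coeff)
    moreover have "F e (\<lambda>_. 1) \<noteq> 0"
      using det_binomial_nonzero[OF that] by (simp add: F_def newton_coeff_const_1)
    ultimately show ?thesis
      unfolding \<mu>_def using AE_polyfun_indep_uniform[of "F e" "\<lambda>_. 1" "{1..d}" \<epsilon> Q lam] \<epsilon> assms(15,16)
      by simp
  qed
  \<comment> \<open>Finitely many exponent choices give one common null set, fixed before solution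
    and multipliers are chosen.\<close>
  moreover have "finite {e :: 'x \<Rightarrow> nat. range e \<subseteq> {..<N}}"
    using finite_PiE[of "UNIV :: 'x set" "\<lambda>_. {..<N}"]
    by (simp add: PiE_UNIV_domain Pi_def image_subset_iff)
  ultimately have "AE \<omega> in M. \<forall>e\<in>{e :: 'x \<Rightarrow> nat. range e \<subseteq> {..<N}}. inj e \<longrightarrow> F e (\<mu> \<omega>) \<noteq> 0"
    by (intro AE_finite_allI) auto
  \<comment> \<open>Samples in the box make the guarantees of \<open>perturbation_radius\<close>
    available.\<close>
  moreover have "AE \<omega> in M. \<forall>k\<in>{1..d}. Q k \<omega> \<in> {-\<epsilon>..\<epsilon>}"
    using rv assms(16) by (intro AE_finite_allI AE_uniform_in_interval) auto
  ultimately show ?thesis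
  proof eventually_elim
    case (elim \<omega>)
    define D' where "D' = problem_P D P lam bs (\<lambda>k. Q k \<omega>)"
    have hor: "horizon D' = N" "horizon D = N" and LC: "LCvx_at D = LCvx_at D'"
      by (simp_all add: D'_def problem_P_def D problem_D_def Let_def LCvx_at_def fun_eq_iff)
    have real: "perturbed_matrix P lam bs (\<lambda>k. Q k \<omega>) $ i $ j \<in> \<real>" for i j
      using assms(13) elim(2) by (simp add: perturbation_radius_def)
    have a1: "assumption_1 D'"
      using assms(13) elim(2) by (simp add: perturbation_radius_def D'_def)
    have "cmat (mat_A D') = perturbed_matrix P lam bs (\<lambda>k. Q k \<omega>)"
      using real by (simp add: D'_def problem_P_def cmat_def Finite_Cartesian_Product.vec_eq_iff)
    also have "\<dots> = P ** jordan_form (\<mu> \<omega>) bs ** matrix_inv P"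
      unfolding perturbed_matrix_def
      by (subst jordan_form_cong[of bs _ "\<mu> \<omega>"]) (auto simp: jd(2) \<mu>_def)
    finally have A: "cmat (mat_A D') = P ** jordan_form (\<mu> \<omega>) bs ** matrix_inv P" .
    have zero: "newton_mat (\<lambda>i. \<mu> \<omega> (\<kappa> i)) (cmat (mat_A D')) k = 0" if "k \<ge> CARD('x)" for k
      unfolding A \<kappa>_def by (rule newton_mat_jordan_eq_0) (use jd that in auto)
    have "card {i \<in> {1..N + 1}. \<not> LCvx_at D u i} \<le> CARD('x) + 1"
      if "optimal D' x u \<sigma>" "dual_vars D' x u \<sigma> \<eta> \<mu>1 \<mu>2" "\<eta> N \<noteq> 0" for x u \<sigma> \<eta> \<mu>1 \<mu>2
      unfolding LC hor(1)[symmetric]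
      by (rule card_violations_le[OF zero])
        (use elim(1) a1 that in \<open>auto simp: F_def hor assumption_1_def optimal_def\<close>)
    then show ?case
      unfolding D'_def by blast
  qed
qed

end
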